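(* Let $v$ be a zero-mean real random variable whose moment generating function $M(\gamma)=\mathbb{E}[e^{\gamma v}]$ is finite in a neighborhood of the origin, let $I(x)=\sup_{\gamma>0}(x\gamma-\log M(\gamma))$, let $H(\beta)=-\beta\log\beta-(1-\beta)\log(1-\beta)$, and let $K>0$ be a real number. Then $$\inf\Big\{x:\ \sup_{0\le\beta\le1}\Big[H(\beta)+\beta\log(K)-\beta I\Big(\frac{x}{\beta}\Big)\Big]<0\Big\}=\inf_{\gamma>0}\Big(\frac{1}{\gamma}H(\beta^* )+\frac{\beta^*}{\gamma}\log\big(KM(\gamma)\big)\Big),$$ where $\beta^*=\beta^*(\gamma)=\dfrac{KM(\gamma)}{1+KM(\gamma)}$.
   Context: In the application $K=\rho(1-p)$, where $\rho$ is the spectral radius of the adjacency matrix of a graph and $p$ an edge-deletion probability ($p=0$ for fixed graphs), and the left-hand side is an upper bound on the growth rate of noisy max-consensus. $\log$ is natural, $0\log0=0$. At $\beta=0$ the term $\beta I(x/\beta)$ is understood as its limit as $\beta\to0^+$. Values $\gamma$ with $M(\gamma)=+\infty$ contribute $-\infty$ to the supremum defining $I$ and $+\infty$ to the infimum on the right-hand side. *)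

theory Defs
  imports "HOL-Probability.Probability"
begin

definition mgf :: "'a measure \<Rightarrow> ('a \<Rightarrow> real) \<Rightarrow> real \<Rightarrow> ennreal" where
  "mgf P v \<gamma> = (\<integral>\<^sup>+ \<omega>. ennreal (exp (\<gamma> * v \<omega>)) \<partial>P)"

definition ext_ln :: "ennreal \<Rightarrow> ereal" where
  "ext_ln a = (if a = 0 then -\<infinity> else if a = \<infinity> then \<infinity> else ereal (ln (enn2real a)))"

(* The supremum runs over positive parameters only, so this is not the full
   Legendre transform of the log-moment generating function. *)
definition rate_fun :: "'a measure \<Rightarrow> ('a \<Rightarrow> real) \<Rightarrow> real \<Rightarrow> ereal" where
  "rate_fun P v x = (SUP \<gamma>\<in>{0<..}. ereal (x * \<gamma>) - ext_ln (mgf P v \<gamma>))"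

(* beta * I(x / beta), extended to beta = 0 by its one-sided limit. *)
definition scaled_rate :: "'a measure \<Rightarrow> ('a \<Rightarrow> real) \<Rightarrow> real \<Rightarrow> real \<Rightarrow> ereal" where
  "scaled_rate P v x \<beta> =
     (if \<beta> = 0 then Lim (at_right 0) (\<lambda>b. ereal b * rate_fun P v (x / b))
      else ereal \<beta> * rate_fun P v (x / \<beta>))"

(* Natural logarithm; since ln 0 = 0 here, the convention 0 * log 0 = 0 holds. *)
definition entropy_nat :: "real \<Rightarrow> real" where
  "entropy_nat \<beta> = - \<beta> * ln \<beta> - (1 - \<beta>) * ln (1 - \<beta>)"

definition beta_star :: "real \<Rightarrow> real \<Rightarrow> real" where
  "beta_star K m = K * m / (1 + K * m)"

definition growth_objective ::
    "real \<Rightarrow> 'a measure \<Rightarrow> ('a \<Rightarrow> real) \<Rightarrow> real \<Rightarrow> ereal" where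
  "growth_objective K P v \<gamma> =
     (if mgf P v \<gamma> = \<infinity> then \<infinity>
      else let m = enn2real (mgf P v \<gamma>); b = beta_star K m in
        ereal (1 / \<gamma> * entropy_nat b + b / \<gamma> * ln (K * m)))"

end

(* By Gibbs' inequality the objective on the right is L(a(g))/g, where L(y) = ln (1 + exp y) is the
   conjugate of -H and a(g) = ln K + ln M(g).  The term of the left supremum at beta is the infimum
   over g of H(beta) + beta a(g) - x g, so the claim is a minimax exchange.  One direction is
   Gibbs' inequality.  For the other, suppose 0 < x < L(a(g))/g for all g.  Then the set
   {(g, y). L(y) <= x g}, convex because L is, is disjoint from the epigraph of a, so that a line
   y = c + m g separates them.  The choice beta = x/m makes the term at beta nonnegative: the line
   lies below a, and c is bounded below because the line lies above the first set.
   For x <= 0 one can take beta = K/(1+K), because M >= 1. *)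
theory Submission
  imports Defs
begin

section \<open>Binary entropy and its conjugate\<close>

definition softplus :: "real \<Rightarrow> real" where
  "softplus y = ln (1 + exp y)"

lemma one_plus_exp_pos: "0 < 1 + exp (y::real)"
  by (simp add: add_pos_pos)

lemma softplus_pos: "0 < softplus y"
  unfolding softplus_def by (simp add: ln_gt_zero)

lemma softplus_mono: "y \<le> z \<Longrightarrow> softplus y \<le> softplus z"
  unfolding softplus_def using one_plus_exp_pos[of y] by (intro ln_mono) auto

lemma softplus_minus: "softplus y - y = softplus (- y)"
proof -
  have "1 + exp y = exp y * (1 + exp (- y))"
    by (simp add: algebra_simps exp_minus)
  then have "ln (1 + exp y) = y + ln (1 + exp (- y))"
    using one_plus_exp_pos[of "- y"] by (simp add: ln_mult)
  then show ?thesis by (simp add: softplus_def)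
qed

text \<open>Gibbs' inequality: the relative entropy of the weights \<open>\<beta>\<close>,
  \<open>1 - \<beta>\<close> with respect to the logistic weights
  \<open>exp y / (1 + exp y)\<close>, \<open>1 / (1 + exp y)\<close> is nonnegative.\<close>

lemma entropy_nat_le_softplus:
  assumes "0 \<le> \<beta>" "\<beta> \<le> 1"
  shows "entropy_nat \<beta> + \<beta> * y \<le> softplus y"
proof -
  consider "\<beta> = 0" | "\<beta> = 1" | "0 < \<beta>" "\<beta> < 1" using assms by linarith
  then show ?thesis
  proof cases
    case 1
    then show ?thesis using softplus_pos[of y] by (simp add: entropy_nat_def)
  next
    case 2
    then show ?thesis
      using softplus_pos[of "- y"] softplus_minus[of y] by (simp add: entropy_nat_def)
  next
    case 3
    define s where "s = softplus y"
    have E: "exp s = 1 + exp y"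
      unfolding s_def softplus_def using one_plus_exp_pos[of y] by simp
    \<comment> \<open>These are the logistic weights written as exponentials.\<close>
    have S: "exp (y - s) + exp (- s) = 1"
      using one_plus_exp_pos[of y]
      by (simp add: exp_diff exp_minus E inverse_eq_divide add_divide_distrib[symmetric] add.commute)
    \<comment> \<open>One summand of Gibbs' inequality. Summed over the two outcomes, the right-hand
      sides cancel, since both pairs of weights have sum 1.\<close>
    have *: "b * (z - ln b) \<le> exp z - b" if "0 < b" for b z :: real
    proof -
      have "1 + (z - ln b) \<le> exp (z - ln b)" by (rule exp_ge_add_one_self)
      also have "\<dots> = exp z / b" using that by (simp add: exp_diff)
      finally show ?thesis using that by (simp add: field_simps)
    qed
    have "\<beta> * (y - s - ln \<beta>) + (1 - \<beta>) * (- s - ln (1 - \<beta>)) \<le> 0"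
      using *[of \<beta> "y - s"] *[of "1 - \<beta>" "- s"] S 3 by simp
    then show ?thesis
      by (simp add: entropy_nat_def s_def algebra_simps)
  qed
qed

text \<open>The equality case of Gibbs' inequality, where the two pairs of weights coincide. For
  \<open>y = ln (K * m)\<close> this \<open>\<beta>\<close> is \<open>beta_star K m\<close>.\<close>

lemma entropy_nat_logistic:
  assumes "\<beta> = exp y / (1 + exp y)"
  shows "entropy_nat \<beta> + \<beta> * y = softplus y"
proof -
  note p = one_plus_exp_pos[of y]
  have 1: "1 - \<beta> = 1 / (1 + exp y)" using p by (simp add: assms field_simps)
  have 2: "ln \<beta> = y - softplus y" using p by (simp add: assms ln_div softplus_def)
  have 3: "ln (1 - \<beta>) = - softplus y" unfolding 1 using p by (simp add: ln_div softplus_def)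
  show ?thesis unfolding entropy_nat_def 2 3 by (simp add: algebra_simps)
qed

lemma logistic_bounds:
  "0 < exp y / (1 + exp (y::real))" "exp y / (1 + exp y) < 1"
  using one_plus_exp_pos[of y] by simp_all

text \<open>A maximum of affine functions is convex: the function
  \<open>entropy_nat b + b * y\<close> that touches \<open>softplus\<close> at the intermediate
  point \<open>z\<close> lies below it at both endpoints.\<close>

lemma convex_on_softplus: "convex_on UNIV softplus"
proof (rule convex_onI)
  fix t x y :: real
  assume t: "0 < t" "t < 1"
  define z where "z = (1 - t) * x + t * y"
  define b where "b = exp z / (1 + exp z)"
  have b: "0 \<le> b" "b \<le> 1"
    unfolding b_def using logistic_bounds[of z] by simp_all
  have "softplus z = (1 - t) * (entropy_nat b + b * x) + t * (entropy_nat b + b * y)"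
    using entropy_nat_logistic[OF b_def] by (simp add: z_def algebra_simps)
  also have "\<dots> \<le> (1 - t) * softplus x + t * softplus y"
    using t entropy_nat_le_softplus[OF b] by (intro add_mono mult_left_mono) auto
  finally show "softplus ((1 - t) *\<^sub>R x + t *\<^sub>R y) \<le> (1 - t) * softplus x + t * softplus y"
    by (simp add: z_def)
qed simp

text \<open>At \<open>\<beta> = 1\<close> the infimum of \<open>softplus y - y\<close> is only approached as \<open>y\<close> tends to infinity.\<close>
lemma le_entropy_natI:
  assumes \<beta>: "0 < \<beta>" "\<beta> \<le> 1" and le: "\<And>y. c \<le> softplus y - \<beta> * y"
  shows "c \<le> entropy_nat \<beta>"
proof (cases "\<beta> = 1")
  case True
  have "((\<lambda>y. softplus (- y)) \<longlongrightarrow> 0) at_top"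
    unfolding softplus_def
    by (rule tendsto_eq_intros filterlim_compose[OF exp_at_bot] filterlim_uminus_at_bot_at_top | simp)+
  moreover have "c \<le> softplus (- y)" for y
    using le[of y] True softplus_minus[of y] by simp
  ultimately have "c \<le> 0"
    by (intro tendsto_lowerbound[of _ 0 at_top c]) auto
  then show ?thesis using True by (simp add: entropy_nat_def)
next
  case False
  \<comment> \<open>The logit inverts the logistic map, so at this point the bound \<open>le\<close>
    has right-hand side exactly \<open>entropy_nat \<beta>\<close>.\<close>
  define y where "y = ln (\<beta> / (1 - \<beta>))"
  have "\<beta> = exp y / (1 + exp y)"
    using \<beta> False by (simp add: y_def field_simps)
  from entropy_nat_logistic[OF this] le[of y] show ?thesis by simp
qed

section \<open>Minimax duality\<close>

text \<open>An exchange of quantifiers: \<open>less\<close> provides some \<open>\<beta>\<close> for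
  each \<open>\<gamma>\<close>, and separation of convex sets in the plane yields one
  \<open>\<beta>\<close> for all. The two distinct points of \<open>D\<close> rule out a vertical
  separating line.\<close>

lemma softplus_duality:
  fixes a :: "real \<Rightarrow> real"
  assumes a: "convex_on D a" and pos: "\<And>\<gamma>. \<gamma> \<in> D \<Longrightarrow> 0 < \<gamma>"
    and two: "\<gamma>1 \<in> D" "\<gamma>2 \<in> D" "\<gamma>1 \<noteq> \<gamma>2" and x: "0 < x"
    and less: "\<And>\<gamma>. \<gamma> \<in> D \<Longrightarrow> x * \<gamma> < softplus (a \<gamma>)"
  obtains \<beta> where "0 < \<beta>" "\<beta> \<le> 1" "\<And>\<gamma>. \<gamma> \<in> D \<Longrightarrow> x * \<gamma> \<le> entropy_nat \<beta> + \<beta> * a \<gamma>"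
proof -
  define S where "S = {p :: real \<times> real. softplus (snd p) \<le> x * fst p}"
  define T where "T = epigraph D a"
  have "convex S"
  proof (rule convexI)
    fix p q :: "real \<times> real" and u w :: real
    assume p: "p \<in> S" and q: "q \<in> S" and uw: "0 \<le> u" "0 \<le> w" "u + w = 1"
    have "softplus (u * snd p + w * snd q) \<le> u * softplus (snd p) + w * softplus (snd q)"
      using convex_on_softplus uw unfolding convex_on_def by simp
    also have "\<dots> \<le> u * (x * fst p) + w * (x * fst q)"
      using p q uw by (intro add_mono mult_left_mono) (auto simp: S_def)
    finally show "u *\<^sub>R p + w *\<^sub>R q \<in> S"
      by (simp add: S_def algebra_simps)
  qed
  moreover have "convex T"
    unfolding T_def using a by (simp add: convex_epigraph convex_on_imp_convex)
  moreover have S_mem: "(softplus y / x, y) \<in> S" for y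
    using x by (simp add: S_def)
  then have "S \<noteq> {}" by blast
  moreover have T_mem: "(\<gamma>, y) \<in> T" if "\<gamma> \<in> D" "a \<gamma> \<le> y" for \<gamma> y
    using that by (simp add: T_def epigraph_def)
  then have "T \<noteq> {}" using two(1) by blast
  moreover have "S \<inter> T = {}"
  proof -
    have False if "(\<gamma>, y) \<in> S" "(\<gamma>, y) \<in> T" for \<gamma> y
      using that less[of \<gamma>] softplus_mono[of "a \<gamma>" y] by (auto simp: S_def T_def epigraph_def)
    then show ?thesis by auto
  qed
  ultimately obtain n b where n: "n \<noteq> 0"
    and nS: "\<forall>p\<in>S. inner n p \<le> b" and nT: "\<forall>p\<in>T. b \<le> inner n p"
    using separating_hyperplane_sets[of S T] by blast
  obtain p q where pq: "n = (p, q)" by fastforce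
  have S1: "p * (softplus y / x) + q * y \<le> b" for y
    using nS S_mem[of y] by (force simp: pq inner_prod_def)
  have T1: "b \<le> p * \<gamma> + q * y" if "\<gamma> \<in> D" "a \<gamma> \<le> y" for \<gamma> y
    using nT T_mem[OF that] by (force simp: pq inner_prod_def)
  \<comment> \<open>The epigraph is unbounded upwards, so a negative \<open>q\<close> would push
    \<open>p * \<gamma>1 + q * y\<close> below \<open>b\<close>.\<close>
  have "0 \<le> q"
  proof (rule ccontr)
    assume "\<not> 0 \<le> q"
    then have q: "q < 0" by simp
    define y where "y = max (a \<gamma>1) ((b - p * \<gamma>1) / q + 1)"
    have "(b - p * \<gamma>1) / q < y" by (simp add: y_def)
    then have "p * \<gamma>1 + q * y < b" using q by (simp add: field_simps)
    moreover have "a \<gamma>1 \<le> y" by (simp add: y_def)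
    ultimately show False using T1[of \<gamma>1 y] two(1) by simp
  qed
  moreover have "q \<noteq> 0"
  proof
    assume q: "q = 0"
    have "p * \<gamma> = b" if g: "\<gamma> \<in> D" for \<gamma>
    proof (rule antisym)
      have "0 < x * \<gamma>" using x pos[OF g] by simp
      then have e: "0 < exp (x * \<gamma>) - 1" by simp
      \<comment> \<open>The inverse of \<open>softplus\<close> gives the boundary point of
        \<open>S\<close> with abscissa \<open>\<gamma>\<close>. A vertical line would thus have to
        pass through every abscissa in \<open>D\<close>.\<close>
      have "softplus (ln (exp (x * \<gamma>) - 1)) = x * \<gamma>"
        unfolding softplus_def using e by simp
      then show "p * \<gamma> \<le> b" using S1[of "ln (exp (x * \<gamma>) - 1)"] q x by simp
      show "b \<le> p * \<gamma>" using T1[OF g, of "a \<gamma>"] q by simp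
    qed
    then have "p * \<gamma>1 = p * \<gamma>2" using two by simp
    then show False using two(3) n pq q by (simp add: zero_prod_def)
  qed
  ultimately have q: "0 < q" by simp
  \<comment> \<open>The separating line is now the graph of \<open>c + m * \<gamma>\<close>, with
    \<open>S\<close> below it (\<open>S2\<close>) and the graph of \<open>a\<close> above it
    (\<open>T2\<close>).\<close>
  define m c where "m = - p / q" and "c = b / q"
  have p: "p = - (m * q)" and b: "b = c * q" using q by (simp_all add: m_def c_def)
  have S2: "y \<le> c + m * (softplus y / x)" for y
  proof -
    have "q * y \<le> q * (c + m * (softplus y / x))"
      using S1[of y] by (simp add: p b algebra_simps)
    then show ?thesis using q by simp
  qed
  have T2: "c + m * \<gamma> \<le> a \<gamma>" if "\<gamma> \<in> D" for \<gamma>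
  proof -
    have "q * (c + m * \<gamma>) \<le> q * a \<gamma>"
      using T1[OF that, of "a \<gamma>"] by (simp add: p b algebra_simps)
    then show ?thesis using q by simp
  qed
  \<comment> \<open>Since \<open>softplus y\<close> is asymptotic to \<open>y\<close>, letting
    \<open>y\<close> grow in \<open>S2\<close> forces \<open>m / x\<close> to be at least 1. The
    witness below makes this quantitative: \<open>softplus y - y\<close> lies between 0 and
    \<open>ln 2\<close> for nonnegative \<open>y\<close>, and \<open>\<bar>r\<bar>\<close> covers a
    negative slope.\<close>
  have "x \<le> m"
  proof (rule ccontr)
    assume "\<not> x \<le> m"
    define r where "r = m / x"
    have r: "r < 1" using \<open>\<not> x \<le> m\<close> x by (simp add: r_def)
    define y where "y = max 0 ((c + \<bar>r\<bar> * ln 2 + 1) / (1 - r))"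
    have y: "0 \<le> y" by (simp add: y_def)
    have "softplus (- y) \<le> softplus 0" using y by (intro softplus_mono) simp
    then have l: "softplus y - y \<le> ln 2" by (simp add: softplus_minus) (simp add: softplus_def)
    have "y \<le> c + r * softplus y" using S2[of y] by (simp add: r_def)
    also have "r * softplus y = r * y + r * (softplus y - y)" by (simp add: algebra_simps)
    also have "r * (softplus y - y) \<le> \<bar>r\<bar> * ln 2"
      using l softplus_minus[of y] softplus_pos[of "- y"] by (intro mult_mono) auto
    finally have "(1 - r) * y \<le> c + \<bar>r\<bar> * ln 2" by (simp add: algebra_simps)
    moreover have "(c + \<bar>r\<bar> * ln 2 + 1) / (1 - r) \<le> y" by (simp add: y_def)
    then have "c + \<bar>r\<bar> * ln 2 + 1 \<le> (1 - r) * y" using r by (simp add: field_simps)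
    ultimately show False by simp
  qed
  then have m: "0 < m" using x by simp
  \<comment> \<open>Scaling the line by this factor turns its slope into \<open>x\<close>; what
    remains is to bound the intercept by the entropy.\<close>
  define \<beta> where "\<beta> = x / m"
  have \<beta>: "0 < \<beta>" "\<beta> \<le> 1" and \<beta>m: "\<beta> * m = x"
    using x m \<open>x \<le> m\<close> by (simp_all add: \<beta>_def)
  \<comment> \<open>\<open>S2\<close> scaled by \<open>\<beta>\<close> bounds
    \<open>softplus y - \<beta> * y\<close> below for every \<open>y\<close>, and the entropy is the
    infimum of these values.\<close>
  have "- (\<beta> * c) \<le> entropy_nat \<beta>"
  proof (rule le_entropy_natI[OF \<beta>])
    fix y
    have "\<beta> * y \<le> \<beta> * (c + m * (softplus y / x))"
      using S2[of y] \<beta> by (intro mult_left_mono) auto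
    also have "\<dots> = \<beta> * c + softplus y"
      using x m by (simp add: \<beta>_def field_simps)
    finally show "- (\<beta> * c) \<le> softplus y - \<beta> * y" by simp
  qed
  moreover have "\<beta> * c + x * \<gamma> \<le> \<beta> * a \<gamma>" if "\<gamma> \<in> D" for \<gamma>
  proof -
    have "\<beta> * (c + m * \<gamma>) \<le> \<beta> * a \<gamma>"
      using T2[OF that] \<beta> by (intro mult_left_mono) auto
    then show ?thesis by (simp add: \<beta>m[symmetric] algebra_simps)
  qed
  ultimately have "x * \<gamma> \<le> entropy_nat \<beta> + \<beta> * a \<gamma>" if "\<gamma> \<in> D" for \<gamma>
    using that by fastforce
  with \<beta> show thesis by (rule that)
qed

section \<open>The log-moment generating function\<close>

text \<open>Where the moment generating function is infinite this is the default value 0, so it is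
  used only on \<open>mgf_dom\<close>.\<close>

definition log_mgf :: "'a measure \<Rightarrow> ('a \<Rightarrow> real) \<Rightarrow> real \<Rightarrow> real" where
  "log_mgf P v \<gamma> = ln (enn2real (mgf P v \<gamma>))"

definition mgf_dom :: "'a measure \<Rightarrow> ('a \<Rightarrow> real) \<Rightarrow> real set" where
  "mgf_dom P v = {\<gamma>. 0 < \<gamma> \<and> mgf P v \<gamma> < \<infinity>}"

lemma integrable_exp_of_mgf_finite:
  assumes "v \<in> borel_measurable P" "mgf P v \<gamma> < \<infinity>"
  shows "integrable P (\<lambda>\<omega>. exp (\<gamma> * v \<omega>))"
  using assms unfolding mgf_def by (intro integrableI_nonneg) auto

lemma mgf_eq_integral:
  assumes "v \<in> borel_measurable P" "mgf P v \<gamma> < \<infinity>"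
  shows "mgf P v \<gamma> = ennreal (\<integral>\<omega>. exp (\<gamma> * v \<omega>) \<partial>P)"
  unfolding mgf_def
  by (rule nn_integral_eq_integral[OF integrable_exp_of_mgf_finite[OF assms]]) simp

lemma enn2real_mgf:
  assumes "v \<in> borel_measurable P" "mgf P v \<gamma> < \<infinity>"
  shows "enn2real (mgf P v \<gamma>) = (\<integral>\<omega>. exp (\<gamma> * v \<omega>) \<partial>P)"
  using mgf_eq_integral[OF assms] by simp

context prob_space
begin

text \<open>Integrate the tangent inequality \<open>1 + t \<le> exp t\<close> at
  \<open>t = \<gamma> * v \<omega>\<close>; the linear term vanishes because the mean is
  zero.\<close>

lemma one_le_mgf:
  assumes v: "integrable M v" "integral\<^sup>L M v = 0" and fin: "mgf M v \<gamma> < \<infinity>"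
  shows "1 \<le> enn2real (mgf M v \<gamma>)"
proof -
  have m: "v \<in> borel_measurable M" using v by auto
  have "(\<integral>\<omega>. 1 + \<gamma> * v \<omega> \<partial>M) \<le> (\<integral>\<omega>. exp (\<gamma> * v \<omega>) \<partial>M)"
    using v integrable_exp_of_mgf_finite[OF m fin]
    by (intro integral_mono) (auto intro: exp_ge_add_one_self)
  moreover have "(\<integral>\<omega>. 1 + \<gamma> * v \<omega> \<partial>M) = 1"
    using v by (simp add: prob_space)
  ultimately show ?thesis using enn2real_mgf[OF m fin] by simp
qed

text \<open>Hoelder's inequality, obtained by integrating the convexity inequality of \<open>exp\<close>
  between the two exponentials normalized to have mean one.\<close>
lemma convex_on_log_mgf:
  assumes v: "integrable M v" "integral\<^sup>L M v = 0"
  shows "convex_on (mgf_dom M v) (log_mgf M v)"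
proof -
  have m: "v \<in> borel_measurable M" using v by auto
  \<comment> \<open>Membership is proved along with the inequality because \<open>convex_on\<close>
    includes convexity of the domain.\<close>
  have *: "u * g + w * h \<in> mgf_dom M v \<and>
      log_mgf M v (u * g + w * h) \<le> u * log_mgf M v g + w * log_mgf M v h"
    if g: "g \<in> mgf_dom M v" and h: "h \<in> mgf_dom M v"
      and uw: "0 \<le> u" "0 \<le> w" "u + w = 1" for g h u w
  proof
    define G H where "G = log_mgf M v g" and "H = log_mgf M v h"
    define C where "C = u * G + w * H"
    have fin: "mgf M v g < \<infinity>" "mgf M v h < \<infinity>" and pos: "0 < g" "0 < h"
      using g h by (auto simp: mgf_dom_def)
    note int = integrable_exp_of_mgf_finite[OF m fin(1)] integrable_exp_of_mgf_finite[OF m fin(2)]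
    have eG: "(\<integral>\<omega>. exp (g * v \<omega>) \<partial>M) = exp G"
      unfolding G_def log_mgf_def enn2real_mgf[OF m fin(1), symmetric]
      using one_le_mgf[OF v fin(1)] by simp
    have eH: "(\<integral>\<omega>. exp (h * v \<omega>) \<partial>M) = exp H"
      unfolding H_def log_mgf_def enn2real_mgf[OF m fin(2), symmetric]
      using one_le_mgf[OF v fin(2)] by simp
    \<comment> \<open>This majorant of the mixed exponential has integral \<open>exp C\<close>. It
      serves twice: for integrability of that exponential and for the bound on its integral.\<close>
    define B where
      "B \<omega> = exp C * (u * (exp (g * v \<omega>) * exp (- G)) + w * (exp (h * v \<omega>) * exp (- H)))" for \<omega>
    have intB: "integrable M B" unfolding B_def using int by auto
    have B: "exp ((u * g + w * h) * v \<omega>) \<le> B \<omega>" for \<omega>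
    proof -
      have "exp (u * (g * v \<omega> - G) + w * (h * v \<omega> - H))
          \<le> u * exp (g * v \<omega> - G) + w * exp (h * v \<omega> - H)"
        using exp_convex uw unfolding convex_on_def by simp
      then have "exp C * exp (u * (g * v \<omega> - G) + w * (h * v \<omega> - H)) \<le> B \<omega>"
        unfolding B_def by (intro mult_left_mono) (simp_all add: exp_diff exp_minus divide_inverse)
      then show ?thesis
        unfolding exp_add[symmetric] by (simp add: C_def algebra_simps)
    qed
    have "integral\<^sup>L M B = exp C * (u * (exp G * exp (- G)) + w * (exp H * exp (- H)))"
      unfolding B_def using int eG eH by simp
    also have "\<dots> = exp C" using uw by (simp add: exp_minus)
    finally have iB: "integral\<^sup>L M B = exp C" .
    have intE: "integrable M (\<lambda>\<omega>. exp ((u * g + w * h) * v \<omega>))"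
      using m B by (intro Bochner_Integration.integrable_bound[OF intB])
        (auto simp: intro: order_trans[OF _ abs_ge_self])
    have "mgf M v (u * g + w * h) = ennreal (\<integral>\<omega>. exp ((u * g + w * h) * v \<omega>) \<partial>M)"
      unfolding mgf_def by (rule nn_integral_eq_integral[OF intE]) simp
    then have finC: "mgf M v (u * g + w * h) < \<infinity>" by simp
    have posC: "0 < u * g + w * h"
    proof (cases "u = 0")
      case True
      then show ?thesis using uw pos by simp
    next
      case False
      then show ?thesis using uw pos by (intro add_pos_nonneg) auto
    qed
    show "u * g + w * h \<in> mgf_dom M v" using finC posC by (simp add: mgf_dom_def)
    have "enn2real (mgf M v (u * g + w * h)) \<le> exp C"
      unfolding enn2real_mgf[OF m finC] iB[symmetric]
      using intE intB B by (intro integral_mono) auto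
    then have "log_mgf M v (u * g + w * h) \<le> C"
      unfolding log_mgf_def using one_le_mgf[OF v finC] ln_mono[of _ "exp C"] by fastforce
    then show "log_mgf M v (u * g + w * h) \<le> u * log_mgf M v g + w * log_mgf M v h"
      by (simp add: C_def G_def H_def)
  qed
  then show ?thesis
    unfolding convex_on_def convex_def by simp
qed

lemma ext_ln_mgf:
  assumes "integrable M v" "integral\<^sup>L M v = 0" "\<gamma> \<in> mgf_dom M v"
  shows "ext_ln (mgf M v \<gamma>) = ereal (log_mgf M v \<gamma>)"
proof -
  have fin: "mgf M v \<gamma> < \<infinity>" using assms(3) by (simp add: mgf_dom_def)
  then have "mgf M v \<gamma> \<noteq> 0" using one_le_mgf[OF assms(1,2) fin] by auto
  then show ?thesis using fin by (simp add: ext_ln_def log_mgf_def)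
qed

lemma log_mgf_nonneg:
  assumes "integrable M v" "integral\<^sup>L M v = 0" "\<gamma> \<in> mgf_dom M v"
  shows "0 \<le> log_mgf M v \<gamma>"
  using one_le_mgf[OF assms(1,2)] assms(3) by (simp add: log_mgf_def mgf_dom_def)

section \<open>The rate function\<close>

text \<open>Parameters outside \<open>mgf_dom\<close> contribute minus infinity to the supremum. The
  bound \<open>c\<close> is extended real because the limit at \<open>\<beta> = 0\<close> may be
  infinite.\<close>

lemma scaled_rate_le:
  assumes v: "integrable M v" "integral\<^sup>L M v = 0" and \<beta>: "0 < \<beta>"
    and le: "\<And>\<gamma>. \<gamma> \<in> mgf_dom M v \<Longrightarrow> ereal (x * \<gamma> - \<beta> * log_mgf M v \<gamma>) \<le> c"
    and dom: "mgf_dom M v \<noteq> {}"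
  shows "ereal \<beta> * rate_fun M v (x / \<beta>) \<le> c"
proof (cases c)
  case (real r)
  have "rate_fun M v (x / \<beta>) \<le> ereal (r / \<beta>)"
    unfolding rate_fun_def
  proof (rule SUP_least)
    fix \<gamma> :: real assume g: "\<gamma> \<in> {0<..}"
    show "ereal (x / \<beta> * \<gamma>) - ext_ln (mgf M v \<gamma>) \<le> ereal (r / \<beta>)"
    proof (cases "\<gamma> \<in> mgf_dom M v")
      case True
      have "x * \<gamma> - \<beta> * log_mgf M v \<gamma> \<le> r" using le[OF True] real by simp
      then have "(x * \<gamma> - \<beta> * log_mgf M v \<gamma>) / \<beta> \<le> r / \<beta>"
        using \<beta> by (intro divide_right_mono) auto
      then show ?thesis using \<beta> ext_ln_mgf[OF v True] by (simp add: diff_divide_distrib)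
    next
      case False
      then have "mgf M v \<gamma> = \<infinity>" using g by (simp add: mgf_dom_def less_top[symmetric])
      then show ?thesis by (simp add: ext_ln_def)
    qed
  qed
  then have "ereal \<beta> * rate_fun M v (x / \<beta>) \<le> ereal \<beta> * ereal (r / \<beta>)"
    using \<beta> by (intro ereal_mult_left_mono) auto
  then show ?thesis using \<beta> real by simp
next
  case MInf
  then show ?thesis using le dom by fastforce
qed simp

lemma scaled_rate_ge:
  assumes v: "integrable M v" "integral\<^sup>L M v = 0" and \<beta>: "0 < \<beta>" and g: "\<gamma> \<in> mgf_dom M v"
  shows "ereal (x * \<gamma> - \<beta> * log_mgf M v \<gamma>) \<le> ereal \<beta> * rate_fun M v (x / \<beta>)"
proof -
  have "ereal (x / \<beta> * \<gamma> - log_mgf M v \<gamma>) \<le> rate_fun M v (x / \<beta>)"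
    unfolding rate_fun_def using g ext_ln_mgf[OF v g]
    by (intro SUP_upper2[of \<gamma>]) (auto simp: mgf_dom_def)
  then have "ereal \<beta> * ereal (x / \<beta> * \<gamma> - log_mgf M v \<gamma>) \<le> ereal \<beta> * rate_fun M v (x / \<beta>)"
    using \<beta> by (intro ereal_mult_left_mono) auto
  then show ?thesis using \<beta> by (simp add: right_diff_distrib)
qed

text \<open>For positive \<open>b\<close> the expression is the supremum of
  \<open>x * \<gamma> - b * log_mgf M v \<gamma>\<close>. As \<open>log_mgf\<close> is nonnegative
  on the domain, it stays below the claimed value, and each single \<open>\<gamma>\<close> shows
  that the value is approached. In particular the limit defining \<open>scaled_rate\<close>
  exists.\<close>

lemma scaled_rate_zero:
  assumes v: "integrable M v" "integral\<^sup>L M v = 0" and dom: "mgf_dom M v \<noteq> {}"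
  shows "scaled_rate M v x 0 = (SUP \<gamma>\<in>mgf_dom M v. ereal (x * \<gamma>))" (is "_ = ?L")
proof -
  have "((\<lambda>b. ereal b * rate_fun M v (x / b)) \<longlongrightarrow> ?L) (at_right 0)"
  proof (rule order_tendstoI)
    fix y assume "y < ?L"
    then obtain \<gamma> where g: "\<gamma> \<in> mgf_dom M v" and y: "y < ereal (x * \<gamma>)"
      by (auto simp: less_SUP_iff)
    have "((\<lambda>b. ereal (x * \<gamma> - b * log_mgf M v \<gamma>)) \<longlongrightarrow> ereal (x * \<gamma>)) (at_right 0)"
      by (auto intro!: tendsto_eq_intros)
    then have "\<forall>\<^sub>F b in at_right 0. y < ereal (x * \<gamma> - b * log_mgf M v \<gamma>)"
      using y by (rule order_tendstoD)
    moreover have "\<forall>\<^sub>F b in at_right (0::real). 0 < b"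
      by (rule eventually_at_right_less)
    ultimately show "\<forall>\<^sub>F b in at_right 0. y < ereal b * rate_fun M v (x / b)"
      by eventually_elim (use scaled_rate_ge[OF v _ g] in \<open>blast intro: less_le_trans\<close>)
  next
    fix y assume y: "?L < y"
    have "ereal b * rate_fun M v (x / b) \<le> ?L" if b: "0 < b" for b
    proof (rule scaled_rate_le[OF v b _ dom])
      fix \<gamma> assume g: "\<gamma> \<in> mgf_dom M v"
      then show "ereal (x * \<gamma> - b * log_mgf M v \<gamma>) \<le> ?L"
        using b log_mgf_nonneg[OF v g] by (intro SUP_upper2[OF g]) simp
    qed
    then have "ereal b * rate_fun M v (x / b) < y" if "0 < b" for b
      using y that by (blast intro: le_less_trans)
    then show "\<forall>\<^sub>F b in at_right 0. ereal b * rate_fun M v (x / b) < y"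
      using eventually_at_right_less[of 0] by (auto elim: eventually_mono)
  qed
  then show ?thesis by (simp add: scaled_rate_def tendsto_Lim)
qed

text \<open>\<open>beta_star\<close> is the logistic weight at \<open>ln (K * m)\<close>, so Gibbs'
  inequality is an equality there.\<close>

lemma growth_objective_eq:
  assumes v: "integrable M v" "integral\<^sup>L M v = 0" and K: "0 < K" and g: "\<gamma> \<in> mgf_dom M v"
  shows "growth_objective K M v \<gamma> = ereal (softplus (ln K + log_mgf M v \<gamma>) / \<gamma>)"
proof -
  define m where "m = enn2real (mgf M v \<gamma>)"
  have fin: "mgf M v \<gamma> < \<infinity>" using g by (simp add: mgf_dom_def)
  have m: "1 \<le> m" using one_le_mgf[OF v fin] by (simp add: m_def)
  have y: "ln (K * m) = ln K + log_mgf M v \<gamma>"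
    using K m by (simp add: log_mgf_def m_def[symmetric] ln_mult)
  have e: "exp (ln (K * m)) = K * m" using K m by simp
  have "beta_star K m = exp (ln (K * m)) / (1 + exp (ln (K * m)))"
    unfolding e by (simp add: beta_star_def)
  from entropy_nat_logistic[OF this] show ?thesis
    using fin unfolding growth_objective_def Let_def m_def[symmetric] y
    by (simp add: add_divide_distrib[symmetric])
qed

end

section \<open>Weak and strong duality for the growth threshold\<close>

theorem mainTheorem8:
  fixes P :: "'a measure" and v :: "'a \<Rightarrow> real" and K :: real
  assumes "prob_space P"
    and "v \<in> borel_measurable P"
    and "integrable P v"
    and "integral\<^sup>L P v = 0"
    and "\<forall>\<^sub>F \<gamma> in nhds 0. mgf P v \<gamma> < \<infinity>"
    and "K > 0"
  shows "Inf {ereal x | x :: real.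
            (SUP \<beta>\<in>{0..1}. ereal (entropy_nat \<beta> + \<beta> * ln K) - scaled_rate P v x \<beta>) < 0}
         = (INF \<gamma>\<in>{0<..}. growth_objective K P v \<gamma>)"
    (is "Inf {ereal x | x. ?F x < 0} = ?R")
proof -
  interpret prob_space P by fact
  note v = assms(3,4) and K = \<open>K > 0\<close>
  define a where "a \<gamma> = ln K + log_mgf P v \<gamma>" for \<gamma>
  obtain d where d: "0 < d" "\<And>\<gamma>. \<bar>\<gamma>\<bar> < d \<Longrightarrow> mgf P v \<gamma> < \<infinity>"
    using assms(5) by (auto simp: eventually_nhds_metric dist_real_def)
  have two: "d / 2 \<in> mgf_dom P v" "d / 3 \<in> mgf_dom P v" "d / 2 \<noteq> d / 3"
    using d(1) d(2)[of "d / 2"] d(2)[of "d / 3"] by (auto simp: mgf_dom_def)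
  then have dom: "mgf_dom P v \<noteq> {}" by blast
  have obj: "growth_objective K P v \<gamma> = ereal (softplus (a \<gamma>) / \<gamma>)" if "\<gamma> \<in> mgf_dom P v" for \<gamma>
    using growth_objective_eq[OF v K that] by (simp add: a_def)
  \<comment> \<open>One good \<open>\<beta>\<close> suffices: taking the supremum over
    \<open>\<gamma>\<close> in \<open>le\<close> makes its term nonnegative.\<close>
  have F_nonneg: "0 \<le> ?F x"
    if \<beta>: "0 < \<beta>" "\<beta> \<le> 1"
      and le: "\<And>\<gamma>. \<gamma> \<in> mgf_dom P v \<Longrightarrow> x * \<gamma> \<le> entropy_nat \<beta> + \<beta> * a \<gamma>" for x \<beta>
  proof (rule SUP_upper2)
    show "\<beta> \<in> {0..1}" using \<beta> by simp
    have "scaled_rate P v x \<beta> \<le> ereal (entropy_nat \<beta> + \<beta> * ln K)"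
      using \<beta> le scaled_rate_le[OF v \<beta>(1) _ dom, of x "ereal (entropy_nat \<beta> + \<beta> * ln K)"]
      by (simp add: scaled_rate_def a_def algebra_simps)
    then show "0 \<le> ereal (entropy_nat \<beta> + \<beta> * ln K) - scaled_rate P v x \<beta>"
      by (cases "scaled_rate P v x \<beta>") auto
  qed
  \<comment> \<open>Weak duality: a single \<open>\<gamma>\<close> bounds the terms for all
    \<open>\<beta>\<close> by the same negative number, so strictness survives the supremum.\<close>
  have upper: "?F x < 0" if g: "\<gamma> \<in> mgf_dom P v" and x: "softplus (a \<gamma>) / \<gamma> < x" for x \<gamma>
  proof -
    have g0: "0 < \<gamma>" using g by (simp add: mgf_dom_def)
    have less: "softplus (a \<gamma>) < x * \<gamma>" using x g0 by (simp add: field_simps)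
    have "?F x \<le> ereal (softplus (a \<gamma>) - x * \<gamma>)"
    proof (rule SUP_least)
      fix \<beta> :: real assume \<beta>: "\<beta> \<in> {0..1}"
      have "ereal (x * \<gamma> - \<beta> * log_mgf P v \<gamma>) \<le> scaled_rate P v x \<beta>"
      proof (cases "\<beta> = 0")
        case True
        then show ?thesis
          using scaled_rate_zero[OF v dom, of x] g by (auto intro: SUP_upper)
      next
        case False
        then show ?thesis
          using scaled_rate_ge[OF v _ g] \<beta> by (simp add: scaled_rate_def)
      qed
      moreover have "entropy_nat \<beta> + \<beta> * a \<gamma> \<le> softplus (a \<gamma>)"
        using entropy_nat_le_softplus \<beta> by simp
      ultimately show "ereal (entropy_nat \<beta> + \<beta> * ln K) - scaled_rate P v x \<beta>
          \<le> ereal (softplus (a \<gamma>) - x * \<gamma>)"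
        by (cases "scaled_rate P v x \<beta>") (auto simp: a_def algebra_simps)
    qed
    also have "\<dots> < 0" using less by simp
    finally show ?thesis .
  qed
  have lower: "?R \<le> ereal x" if F: "?F x < 0" for x
  proof (rule ccontr)
    assume "\<not> ?R \<le> ereal x"
    then have "ereal x < ?R" by simp
    moreover have "?R \<le> ereal (softplus (a \<gamma>) / \<gamma>)" if "\<gamma> \<in> mgf_dom P v" for \<gamma>
      using that obj[OF that] by (intro INF_lower2[of \<gamma>]) (auto simp: mgf_dom_def)
    ultimately have "ereal x < ereal (softplus (a \<gamma>) / \<gamma>)" if "\<gamma> \<in> mgf_dom P v" for \<gamma>
      using that by (blast intro: less_le_trans)
    then have less: "x * \<gamma> < softplus (a \<gamma>)" if "\<gamma> \<in> mgf_dom P v" for \<gamma>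
      using that by (fastforce simp: mgf_dom_def field_simps)
    show False
    proof (cases "0 < x")
      case True
      have "convex_on (mgf_dom P v) a"
        unfolding a_def using convex_on_log_mgf[OF v]
        by (intro convex_on_add) (auto simp: convex_on_const convex_on_imp_convex)
      moreover have "0 < \<gamma>" if "\<gamma> \<in> mgf_dom P v" for \<gamma>
        using that by (simp add: mgf_dom_def)
      ultimately obtain \<beta> where "0 < \<beta>" "\<beta> \<le> 1"
          "\<And>\<gamma>. \<gamma> \<in> mgf_dom P v \<Longrightarrow> x * \<gamma> \<le> entropy_nat \<beta> + \<beta> * a \<gamma>"
        using softplus_duality[OF _ _ two True less] by blast
      from F_nonneg[OF this] F show False by simp
    next
      case False
      \<comment> \<open>This is \<open>K / (1 + K)\<close>, where
        \<open>entropy_nat \<beta> + \<beta> * ln K\<close> attains its maximum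
        \<open>softplus (ln K)\<close>, a positive number.\<close>
      define \<beta> where "\<beta> = exp (ln K) / (1 + exp (ln K))"
      have \<beta>: "0 < \<beta>" "\<beta> \<le> 1" unfolding \<beta>_def using logistic_bounds[of "ln K"] by auto
      have "x * \<gamma> \<le> entropy_nat \<beta> + \<beta> * a \<gamma>" if g: "\<gamma> \<in> mgf_dom P v" for \<gamma>
      proof -
        have "x * \<gamma> \<le> 0" using False g by (simp add: mgf_dom_def mult_nonpos_nonneg)
        also have "0 \<le> entropy_nat \<beta> + \<beta> * ln K"
          using entropy_nat_logistic[OF \<beta>_def] softplus_pos[of "ln K"] by simp
        also have "\<dots> \<le> entropy_nat \<beta> + \<beta> * a \<gamma>"
          using \<beta> log_mgf_nonneg[OF v g] by (simp add: a_def)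
        finally show ?thesis .
      qed
      from F_nonneg[OF \<beta> this] F show False by simp
    qed
  qed
  show ?thesis
  proof (rule antisym)
    show "Inf {ereal x | x. ?F x < 0} \<le> ?R"
    proof (rule INF_greatest)
      fix \<gamma> :: real assume g: "\<gamma> \<in> {0<..}"
      show "Inf {ereal x | x. ?F x < 0} \<le> growth_objective K P v \<gamma>"
      proof (cases "\<gamma> \<in> mgf_dom P v")
        case True
        show ?thesis unfolding obj[OF True]
        \<comment> \<open>\<open>upper\<close> requires \<open>x\<close> strictly above the
          objective, hence the margin \<open>e\<close>.\<close>
        proof (rule ereal_le_epsilon2)
          fix e :: real assume e: "0 < e"
          then have "?F (softplus (a \<gamma>) / \<gamma> + e) < 0" by (intro upper[OF True]) simp
          then show "Inf {ereal x | x. ?F x < 0} \<le> ereal (softplus (a \<gamma>) / \<gamma>) + ereal e"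
            by (intro Inf_lower) auto
        qed
      next
        case False
        then have "mgf P v \<gamma> = \<infinity>" using g by (simp add: mgf_dom_def less_top[symmetric])
        then show ?thesis by (simp add: growth_objective_def)
      qed
    qed
  next
    show "?R \<le> Inf {ereal x | x. ?F x < 0}"
      using lower by (auto intro!: Inf_greatest)
  qed
qed

end
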